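(* Let $p\ge 1$, $\alpha\ge 1$, let $k$ be a positive integer, and let $P_1,\ldots,P_L$ be polygonal curves in $\mathbb{R}^2$. If an $\alpha$-approximation min-$\epsilon$ simplification algorithm is used, then the $p$-Mean Algorithm has approximation factor $2\alpha+1$: its output $M'$ satisfies $$\left(\sum_{i=1}^L d_F(M',P_i)^p\right)^{1/p}\le (2\alpha+1)\left(\sum_{i=1}^L d_F(M,P_i)^p\right)^{1/p},$$ where $M$ is an optimal $p$-mean curve of $P_1,\ldots,P_L$ with at most $k$ vertices.
   Context: A polygonal curve $P$ is a finite sequence of points in $\mathbb{R}^2$ together with the segments connecting consecutive points, regarded as a continuous map $[0,1]\to\mathbb{R}^2$. The Fréchet distance is $d_F(P,Q)=\inf_{\gamma,\delta}\max_{t\in[0,1]} \|P(\gamma(t))-Q(\delta(t))\|_2$, over continuous non-decreasing bijections $\gamma,\delta:[0,1]\to[0,1]$. A $p$-mean curve ($p$-MC) of a family of polygonal curves $Q_1,\ldots,Q_L$ is a polygonal curve with at most $k$ vertices (arbitrary points of the plane) that minimizes $\left(\sum_{i=1}^L d_F(\cdot,Q_i)^p\right)^{1/p}$ among all polygonal curves with at most $k$ vertices. An $\alpha$-approximation min-$\epsilon$ simplification algorithm returns, for a polygonal curve $P$, a polygonal curve $P'$ with at most $k$ vertices such that $d_F(P,P')\le\alpha\cdot d_F(P,S)$ for every polygonal curve $S$ with at most $k$ vertices. $p$-Mean Algorithm: (1) for each $i=1,\ldots,L$ compute $P'_i$, the output of the $\alpha$-approximation min-$\epsilon$ simplification algorithm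 on $P_i$; (2) output $M'$, a $p$-MC (with at most $k$ vertices) of $P'_1,\ldots,P'_L$. *)

theory Defs
  imports "HOL-Analysis.Analysis"
begin

(* A polygonal curve is represented by its finite nonempty list of vertices. A single point is
   a curve with one vertex, and repeated vertices are allowed. *)
type_synonym poly_curve = "(real^2) list"

definition polygonal_curve :: "poly_curve \<Rightarrow> bool" where
  "polygonal_curve V \<longleftrightarrow> V \<noteq> []"

definition curves_upto :: "nat \<Rightarrow> poly_curve set" where
  "curves_upto k = {V. polygonal_curve V \<and> length V \<le> k}"

(* One parametrization over [0,1] of the segments joining consecutive vertices. The speeds that
   the path join operation assigns to the segments are immaterial for the Frechet distance.
   The value at the empty list is a dummy. *)
fun curve_map :: "poly_curve \<Rightarrow> real \<Rightarrow> real^2" where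
  "curve_map [] = linepath 0 0"
| "curve_map [a] = linepath a a"
| "curve_map [a, b] = linepath a b"
| "curve_map (a # b # c # V) = linepath a b +++ curve_map (b # c # V)"

lemma pathstart_curve_map: "V \<noteq> [] \<Longrightarrow> pathstart (curve_map V) = hd V"
  by (induction V rule: curve_map.induct) auto

lemma pathfinish_curve_map: "V \<noteq> [] \<Longrightarrow> pathfinish (curve_map V) = last V"
  by (induction V rule: curve_map.induct) auto

lemma path_curve_map: "path (curve_map V)"
  by (induction V rule: curve_map.induct) (auto simp: pathstart_curve_map path_const)

definition reparametrizations :: "(real \<Rightarrow> real) set" where
  "reparametrizations =
     {\<gamma>. continuous_on {0..1} \<gamma> \<and> mono_on {0..1} \<gamma> \<and> bij_betw \<gamma> {0..1} {0..1}}"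

(* The inner supremum is a maximum, since the curves are continuous on the compact interval [0,1]. *)
definition frechet_dist :: "poly_curve \<Rightarrow> poly_curve \<Rightarrow> real" where
  "frechet_dist P Q =
     (INF (\<gamma>, \<delta>) \<in> reparametrizations \<times> reparametrizations.
        SUP t\<in>{0..1}. norm (curve_map P (\<gamma> t) - curve_map Q (\<delta> t)))"

definition p_mean_cost :: "real \<Rightarrow> nat \<Rightarrow> (nat \<Rightarrow> poly_curve) \<Rightarrow> poly_curve \<Rightarrow> real" where
  "p_mean_cost p L Q S = (\<Sum>i=1..L. frechet_dist S (Q i) powr p) powr (1 / p)"

definition is_p_mean_curve ::
  "real \<Rightarrow> nat \<Rightarrow> nat \<Rightarrow> (nat \<Rightarrow> poly_curve) \<Rightarrow> poly_curve \<Rightarrow> bool" where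
  "is_p_mean_curve p k L Q M \<longleftrightarrow>
     M \<in> curves_upto k \<and> (\<forall>S \<in> curves_upto k. p_mean_cost p L Q M \<le> p_mean_cost p L Q S)"

definition approx_min_eps_simplification ::
  "real \<Rightarrow> nat \<Rightarrow> (poly_curve \<Rightarrow> poly_curve) \<Rightarrow> bool" where
  "approx_min_eps_simplification \<alpha> k simplify \<longleftrightarrow>
     (\<forall>P. polygonal_curve P \<longrightarrow>
        simplify P \<in> curves_upto k \<and>
        (\<forall>S \<in> curves_upto k. frechet_dist P (simplify P) \<le> \<alpha> * frechet_dist P S))"

(* The algorithm is rendered by its input-output relation, because a p-mean curve of the
   simplified curves need not be unique. *)
definition p_mean_algorithm_output ::
  "real \<Rightarrow> nat \<Rightarrow> (poly_curve \<Rightarrow> poly_curve) \<Rightarrow> nat \<Rightarrow> (nat \<Rightarrow> poly_curve) \<Rightarrow> poly_curve \<Rightarrow> bool" where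
  "p_mean_algorithm_output p k simplify L P M' \<longleftrightarrow>
     is_p_mean_curve p k L (\<lambda>i. simplify (P i)) M'"

end

theory Submission
  imports Defs
begin

text \<open>The Frechet distance is a symmetric function satisfying the triangle inequality: a matching
  of \<open>P\<close> with \<open>Q\<close> and one of \<open>Q\<close> with \<open>R\<close> are composed by inverting the reparametrization of \<open>Q\<close>
  in the first. Hence \<open>d(M', P\<^sub>i) \<le> d(M', P'\<^sub>i) + d(P'\<^sub>i, P\<^sub>i)\<close>, where the second term is at most
  \<open>\<alpha> d(M, P\<^sub>i)\<close>. Optimality of \<open>M'\<close> for the curves \<open>P'\<^sub>i\<close> replaces the first term, in the \<open>p\<close>-norm,
  by \<open>d(M, P'\<^sub>i) \<le> (1 + \<alpha>) d(M, P\<^sub>i)\<close>. Minkowski's inequality adds the two contributions.\<close>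

section \<open>Minkowski's inequality\<close>

text \<open>Convexity on the positive reals extends to the endpoint 0, where it reduces to
  \<open>t powr p \<le> t\<close> for t in (0,1). The endpoint matters because Frechet distances may
  vanish.\<close>

lemma powr_convex_nonneg:
  fixes p :: real
  assumes "p \<ge> 1"
  shows "convex_on {0..} (\<lambda>x. x powr p)"
proof (rule convex_on_linorderI)
  fix t x y :: real
  assume t: "0 < t" "t < 1" and xy: "x \<in> {0..}" "y \<in> {0..}" "x < y"
  show "((1 - t) *\<^sub>R x + t *\<^sub>R y) powr p \<le> (1 - t) * x powr p + t * y powr p"
  proof (cases "x = 0")
    case True
    have "t powr p \<le> t powr 1"
      using t assms by (intro powr_mono') auto
    then show ?thesis
      using True t xy by (auto simp: powr_mult intro!: mult_right_mono)
  next
    case False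
    then show ?thesis
      using convex_onD[OF powr_convex[OF assms], of t x y] t xy by auto
  qed
qed simp

text \<open>Normalise by the two p-norms A and B: \<open>(a i + b i) / (A + B)\<close> is a convex
  combination of \<open>a i / A\<close> and \<open>b i / B\<close>. Convexity of the p-th power is
  applied termwise and summed over I.\<close>

lemma Minkowski_sum_powr:
  fixes a b :: "'a \<Rightarrow> real" and p :: real
  assumes p: "p \<ge> 1" and "finite I"
    and a: "\<And>i. i \<in> I \<Longrightarrow> a i \<ge> 0" and b: "\<And>i. i \<in> I \<Longrightarrow> b i \<ge> 0"
  shows "(\<Sum>i\<in>I. (a i + b i) powr p) powr (1 / p)
       \<le> (\<Sum>i\<in>I. a i powr p) powr (1 / p) + (\<Sum>i\<in>I. b i powr p) powr (1 / p)"
proof -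
  define A where "A = (\<Sum>i\<in>I. a i powr p) powr (1 / p)"
  define B where "B = (\<Sum>i\<in>I. b i powr p) powr (1 / p)"
  have A_powr: "A powr p = (\<Sum>i\<in>I. a i powr p)" and B_powr: "B powr p = (\<Sum>i\<in>I. b i powr p)"
    using p by (simp_all add: A_def B_def powr_powr sum_nonneg)
  have AB: "A \<ge> 0" "B \<ge> 0"
    by (auto simp: A_def B_def)
  \<comment> \<open>The normalisation divides by A and B. If one of them is 0, the corresponding
    family vanishes on I and the inequality becomes an equality.\<close>
  consider "A = 0" | "B = 0" | "A > 0" "B > 0"
    using AB by fastforce
  then have "(\<Sum>i\<in>I. (a i + b i) powr p) powr (1 / p) \<le> A + B"
  proof cases
    case 1
    then have "\<forall>i\<in>I. a i = 0"
      using A_powr \<open>finite I\<close> by (simp add: sum_nonneg_eq_0_iff)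
    then show ?thesis
      using 1 by (simp add: B_def)
  next
    case 2
    then have "\<forall>i\<in>I. b i = 0"
      using B_powr \<open>finite I\<close> by (simp add: sum_nonneg_eq_0_iff)
    then show ?thesis
      using 2 by (simp add: A_def)
  next
    case 3
    \<comment> \<open>This weight gives \<open>(A + B) * (1 - t) = A\<close> and
      \<open>(A + B) * t = B\<close>, so the normalising factors cancel.\<close>
    define t where "t = B / (A + B)"
    have t: "0 \<le> t" "t \<le> 1" "1 - t = A / (A + B)"
      using 3 by (auto simp: t_def field_simps)
    have "(a i + b i) powr p
        \<le> (A + B) powr p * ((1 - t) * (a i powr p / A powr p) + t * (b i powr p / B powr p))"
      if "i \<in> I" for i
    proof -
      have "a i + b i = (A + B) * ((1 - t) *\<^sub>R (a i / A) + t *\<^sub>R (b i / B))"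
        using 3 by (simp add: t(3)) (simp add: t_def distrib_left)
      moreover have "((1 - t) *\<^sub>R (a i / A) + t *\<^sub>R (b i / B)) powr p
          \<le> (1 - t) * (a i / A) powr p + t * (b i / B) powr p"
        using convex_onD[OF powr_convex_nonneg[OF p], of t "a i / A" "b i / B"] t 3 a b that
        by auto
      moreover have "0 \<le> (1 - t) *\<^sub>R (a i / A) + t *\<^sub>R (b i / B)"
        using t(1,2) 3 a b that by auto
      ultimately show ?thesis
        using 3 a b that by (simp add: powr_mult powr_divide mult_left_mono)
    qed
    then have "(\<Sum>i\<in>I. (a i + b i) powr p)
        \<le> (\<Sum>i\<in>I. (A + B) powr p * ((1 - t) * (a i powr p / A powr p) + t * (b i powr p / B powr p)))"
      by (rule sum_mono)
    also have "\<dots> = (A + B) powr p * ((1 - t) * (\<Sum>i\<in>I. a i powr p) / A powr p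
        + t * (\<Sum>i\<in>I. b i powr p) / B powr p)"
      by (simp add: sum.distrib flip: sum_distrib_left sum_divide_distrib)
    \<comment> \<open>Each normalised family has p-th powers summing to 1, so the bracket is
      \<open>(1 - t) + t\<close>.\<close>
    also have "\<dots> = (A + B) powr p"
      using 3 by (simp flip: A_powr B_powr)
    finally have "(\<Sum>i\<in>I. (a i + b i) powr p) powr (1 / p) \<le> ((A + B) powr p) powr (1 / p)"
      using p by (intro powr_mono2) (auto intro: sum_nonneg)
    then show ?thesis
      using p AB by (simp add: powr_powr)
  qed
  then show ?thesis
    by (simp add: A_def B_def)
qed

section \<open>The Frechet distance as a pseudometric\<close>

lemma reparametrizations_id: "(\<lambda>t. t) \<in> reparametrizations"
  by (auto simp: reparametrizations_def mono_on_def bij_betw_def inj_on_def)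

lemma reparametrizations_comp:
  assumes "\<gamma> \<in> reparametrizations" "\<delta> \<in> reparametrizations"
  shows "\<gamma> \<circ> \<delta> \<in> reparametrizations"
proof -
  have img: "\<delta> ` {0..1} = {0..1}"
    using assms(2) by (simp add: reparametrizations_def bij_betw_def)
  have "continuous_on {0..1} (\<gamma> \<circ> \<delta>)"
    using assms by (intro continuous_on_compose) (auto simp: reparametrizations_def img)
  moreover have "mono_on {0..1} (\<gamma> \<circ> \<delta>)"
    using assms img by (intro monotone_on_o) (auto simp: reparametrizations_def)
  moreover have "bij_betw (\<gamma> \<circ> \<delta>) {0..1} {0..1}"
    using assms by (intro bij_betw_trans) (auto simp: reparametrizations_def)
  ultimately show ?thesis
    by (simp add: reparametrizations_def)
qed

text \<open>The inverse is continuous because \<open>{0..1}\<close> is compact. It is monotone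
  because inverse values in the wrong order would, by monotonicity of \<gamma>, force x = y.\<close>

lemma reparametrizations_inv:
  assumes "\<gamma> \<in> reparametrizations"
  shows "the_inv_into {0..1} \<gamma> \<in> reparametrizations"
proof -
  have cont: "continuous_on {0..1} \<gamma>" and mono: "mono_on {0..1} \<gamma>"
    and bij: "bij_betw \<gamma> {0..1} {0..1}"
    using assms by (auto simp: reparametrizations_def)
  let ?g = "the_inv_into {0..1} \<gamma>"
  have img: "\<gamma> ` {0..1} = {0..1}" and inj: "inj_on \<gamma> {0..1}"
    using bij by (auto simp: bij_betw_def)
  have "continuous_on {0..1} ?g"
    using continuous_on_inv_into[OF cont _ inj] by (simp add: img)
  moreover have bij': "bij_betw ?g {0..1} {0..1}"
    by (rule bij_betw_the_inv_into[OF bij])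
  moreover have "mono_on {0..1} ?g"
  proof (rule mono_onI)
    fix x y :: real
    assume xy: "x \<in> {0..1}" "y \<in> {0..1}" "x \<le> y"
    have g: "?g x \<in> {0..1}" "?g y \<in> {0..1}" "\<gamma> (?g x) = x" "\<gamma> (?g y) = y"
      using bij_betwE[OF bij'] f_the_inv_into_f_bij_betw[OF bij] xy by auto
    show "?g x \<le> ?g y"
      using mono_onD[OF mono g(2) g(1)] g(3,4) xy(3) by fastforce
  qed
  ultimately show ?thesis
    by (simp add: reparametrizations_def)
qed

lemma reparametrizations_mem:
  "\<gamma> \<in> reparametrizations \<Longrightarrow> t \<in> {0..1} \<Longrightarrow> \<gamma> t \<in> {0..1}"
  unfolding reparametrizations_def using bij_betwE by fastforce

lemma continuous_on_curve_map_reparametrization: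
  assumes "\<gamma> \<in> reparametrizations"
  shows "continuous_on {0..1} (\<lambda>t. curve_map P (\<gamma> t))"
proof (rule continuous_on_compose2[where g = "curve_map P" and f = \<gamma>])
  show "continuous_on {0..1} (curve_map P)"
    using path_curve_map by (simp add: path_def)
  show "continuous_on {0..1} \<gamma>"
    using assms by (simp add: reparametrizations_def)
  show "\<gamma> ` {0..1} \<subseteq> {0..1}"
    using assms reparametrizations_mem by blast
qed

text \<open>A continuous function on a compact interval is bounded. This makes the real-valued
  supremum a genuine upper bound.\<close>

lemma bdd_above_matching:
  assumes "\<gamma> \<in> reparametrizations" "\<delta> \<in> reparametrizations"
  shows "bdd_above ((\<lambda>t. norm (curve_map P (\<gamma> t) - curve_map Q (\<delta> t))) ` {0..1})"
  using assms
  by (intro bounded_imp_bdd_above compact_imp_bounded compact_continuous_image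
      continuous_intros continuous_on_curve_map_reparametrization) auto

lemma matching_sup_nonneg:
  assumes "\<gamma> \<in> reparametrizations" "\<delta> \<in> reparametrizations"
  shows "0 \<le> (SUP t\<in>{0..1}. norm (curve_map P (\<gamma> t) - curve_map Q (\<delta> t)))"
  by (rule cSUP_upper2[OF bdd_above_matching[OF assms], of 0]) auto

lemma frechet_dist_nonneg: "0 \<le> frechet_dist P Q"
  unfolding frechet_dist_def
  using reparametrizations_id by (intro cINF_greatest) (auto intro: matching_sup_nonneg)

text \<open>All matching costs are bounded below by 0, so the infimum lies below the cost of any
  single matching.\<close>

lemma frechet_dist_le:
  assumes "\<gamma> \<in> reparametrizations" "\<delta> \<in> reparametrizations"
    and "\<And>t. t \<in> {0..1} \<Longrightarrow> norm (curve_map P (\<gamma> t) - curve_map Q (\<delta> t)) \<le> c"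
  shows "frechet_dist P Q \<le> c"
  unfolding frechet_dist_def
proof (rule cINF_lower2[where x = "(\<gamma>, \<delta>)"])
  show "bdd_below ((\<lambda>(\<gamma>, \<delta>). SUP t\<in>{0..1}. norm (curve_map P (\<gamma> t) - curve_map Q (\<delta> t)))
      ` (reparametrizations \<times> reparametrizations))"
    by (rule bdd_belowI[of _ 0]) (auto intro: matching_sup_nonneg)
qed (use assms in \<open>auto intro!: cSUP_least\<close>)

text \<open>Converse direction: a strict bound on the infimum yields a matching below it, so no
  optimal matching has to exist.\<close>

lemma frechet_dist_lessE:
  assumes "frechet_dist P Q < c"
  obtains \<gamma> \<delta> where "\<gamma> \<in> reparametrizations" "\<delta> \<in> reparametrizations"
    "\<forall>t\<in>{0..1}. norm (curve_map P (\<gamma> t) - curve_map Q (\<delta> t)) < c"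
proof -
  have "reparametrizations \<times> reparametrizations \<noteq> {}"
    using reparametrizations_id by auto
  from cInf_lessD[OF _ assms[unfolded frechet_dist_def]] this
  obtain \<gamma> \<delta> where rep: "\<gamma> \<in> reparametrizations" "\<delta> \<in> reparametrizations"
    and sup: "(SUP t\<in>{0..1}. norm (curve_map P (\<gamma> t) - curve_map Q (\<delta> t))) < c"
    by auto
  show thesis
  proof (rule that[OF rep], rule ballI)
    fix t :: real
    assume "t \<in> {0..1}"
    from cSUP_upper[OF this bdd_above_matching[OF rep]] sup
    show "norm (curve_map P (\<gamma> t) - curve_map Q (\<delta> t)) < c"
      by (rule le_less_trans)
  qed
qed

text \<open>Swapping the two reparametrizations turns a matching of Q with P into one of P with Q of
  the same cost.\<close>

lemma frechet_dist_commute_le: "frechet_dist P Q \<le> frechet_dist Q P"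
proof (rule dense_ge)
  fix c assume "frechet_dist Q P < c"
  then obtain \<gamma> \<delta> where "\<gamma> \<in> reparametrizations" "\<delta> \<in> reparametrizations"
    "\<forall>t\<in>{0..1}. norm (curve_map Q (\<gamma> t) - curve_map P (\<delta> t)) < c"
    by (rule frechet_dist_lessE)
  then show "frechet_dist P Q \<le> c"
    by (intro frechet_dist_le[of \<delta> \<gamma>]) (auto simp: norm_minus_commute less_imp_le)
qed

lemma frechet_dist_commute: "frechet_dist P Q = frechet_dist Q P"
  by (intro antisym frechet_dist_commute_le)

lemma frechet_dist_triangle: "frechet_dist P R \<le> frechet_dist P Q + frechet_dist Q R"
proof (rule field_le_epsilon)
  fix e :: real assume e: "e > 0"
  from e have "frechet_dist P Q < frechet_dist P Q + e / 2" by simp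
  then obtain \<gamma> \<delta> where PQ: "\<gamma> \<in> reparametrizations" "\<delta> \<in> reparametrizations"
    "\<forall>t\<in>{0..1}. norm (curve_map P (\<gamma> t) - curve_map Q (\<delta> t)) < frechet_dist P Q + e / 2"
    by (rule frechet_dist_lessE)
  from e have "frechet_dist Q R < frechet_dist Q R + e / 2" by simp
  then obtain \<gamma>' \<delta>' where QR: "\<gamma>' \<in> reparametrizations" "\<delta>' \<in> reparametrizations"
    "\<forall>t\<in>{0..1}. norm (curve_map Q (\<gamma>' t) - curve_map R (\<delta>' t)) < frechet_dist Q R + e / 2"
    by (rule frechet_dist_lessE)
  \<comment> \<open>Chosen so that \<open>\<delta> (\<sigma> t) = \<gamma>' t\<close>: both
    matchings then visit the same point of Q at time t.\<close>
  define \<sigma> where "\<sigma> = the_inv_into {0..1} \<delta> \<circ> \<gamma>'"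
  have \<sigma>: "\<sigma> \<in> reparametrizations"
    unfolding \<sigma>_def using PQ QR by (intro reparametrizations_comp reparametrizations_inv)
  show "frechet_dist P R \<le> frechet_dist P Q + frechet_dist Q R + e"
  proof (rule frechet_dist_le[OF reparametrizations_comp[OF PQ(1) \<sigma>] QR(2)])
    fix t :: real assume t: "t \<in> {0..1}"
    have "bij_betw \<delta> {0..1} {0..1}"
      using PQ(2) by (simp add: reparametrizations_def)
    then have "\<delta> (\<sigma> t) = \<gamma>' t"
      unfolding \<sigma>_def comp_def
      by (rule f_the_inv_into_f_bij_betw) (use t QR(1) reparametrizations_mem in blast)
    then have "norm (curve_map P (\<gamma> (\<sigma> t)) - curve_map Q (\<gamma>' t)) < frechet_dist P Q + e / 2"
      using bspec[OF PQ(3) reparametrizations_mem[OF \<sigma> t]] by simp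
    with bspec[OF QR(3) t]
    show "norm (curve_map P ((\<gamma> \<circ> \<sigma>) t) - curve_map R (\<delta>' t))
        \<le> frechet_dist P Q + frechet_dist Q R + e"
      using norm_triangle_ineq[of "curve_map P (\<gamma> (\<sigma> t)) - curve_map Q (\<gamma>' t)"
          "curve_map Q (\<gamma>' t) - curve_map R (\<delta>' t)"]
      by simp
  qed
qed

section \<open>The approximation factor\<close>

text \<open>Homogeneity of the p-norm, used to extract the factors \<alpha> and 1 +
  \<alpha>.\<close>

lemma powr_sum_cmult:
  fixes d :: "'a \<Rightarrow> real" and c p :: real
  assumes "p > 0" "c \<ge> 0" "\<And>i. i \<in> I \<Longrightarrow> d i \<ge> 0"
  shows "(\<Sum>i\<in>I. (c * d i) powr p) powr (1 / p) = c * (\<Sum>i\<in>I. d i powr p) powr (1 / p)"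
proof -
  have "(\<Sum>i\<in>I. (c * d i) powr p) = c powr p * (\<Sum>i\<in>I. d i powr p)"
    using assms by (simp add: powr_mult sum_distrib_left)
  then show ?thesis
    using assms by (simp add: powr_mult powr_powr sum_nonneg)
qed

lemma powr_sum_mono:
  fixes x y :: "'a \<Rightarrow> real" and p :: real
  assumes "p > 0" "\<And>i. i \<in> I \<Longrightarrow> 0 \<le> x i" "\<And>i. i \<in> I \<Longrightarrow> x i \<le> y i"
  shows "(\<Sum>i\<in>I. x i powr p) powr (1 / p) \<le> (\<Sum>i\<in>I. y i powr p) powr (1 / p)"
  using assms by (intro powr_mono2 sum_mono sum_nonneg) auto

theorem theorem3:
  fixes p \<alpha> :: real
    and k L :: nat
    and P :: "nat \<Rightarrow> poly_curve"
    and simplify :: "poly_curve \<Rightarrow> poly_curve"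
    and M M' :: poly_curve
  assumes "p \<ge> 1"
    and "\<alpha> \<ge> 1"
    and "k \<ge> 1"
    and "\<And>i. i \<in> {1..L} \<Longrightarrow> polygonal_curve (P i)"
    and "approx_min_eps_simplification \<alpha> k simplify"
    and "p_mean_algorithm_output p k simplify L P M'"
    and "is_p_mean_curve p k L P M"
  shows "(\<Sum>i=1..L. frechet_dist M' (P i) powr p) powr (1 / p)
       \<le> (2 * \<alpha> + 1) * (\<Sum>i=1..L. frechet_dist M (P i) powr p) powr (1 / p)"
proof -
  let ?N = "\<lambda>d. (\<Sum>i=1..L. d i powr p) powr (1 / p)"
  define d where "d i = frechet_dist M (P i)" for i
  define P' where "P' i = simplify (P i)" for i
  have M: "M \<in> curves_upto k"
    using assms(7) by (simp add: is_p_mean_curve_def)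
  have d: "0 \<le> d i" for i
    by (simp add: d_def frechet_dist_nonneg)
  \<comment> \<open>M has at most k vertices, so it is an admissible S in the simplification
    guarantee for every \<open>P i\<close>.\<close>
  have simp_le: "frechet_dist (P' i) (P i) \<le> \<alpha> * d i" if "i \<in> {1..L}" for i
    using assms(4)[OF that] assms(5) M
    unfolding approx_min_eps_simplification_def d_def P'_def
    by (metis frechet_dist_commute)
  have M'_le: "frechet_dist M' (P i) \<le> frechet_dist M' (P' i) + \<alpha> * d i" if "i \<in> {1..L}" for i
    using frechet_dist_triangle[of M' "P i" "P' i"] simp_le[OF that] by linarith
  have M_le: "frechet_dist M (P' i) \<le> (1 + \<alpha>) * d i" if "i \<in> {1..L}" for i
    using frechet_dist_triangle[of M "P' i" "P i"] simp_le[OF that]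
    by (simp add: frechet_dist_commute[of "P i"] d_def algebra_simps)
  have "?N (\<lambda>i. frechet_dist M' (P i)) \<le> ?N (\<lambda>i. frechet_dist M' (P' i) + \<alpha> * d i)"
    using assms(1) M'_le by (intro powr_sum_mono) (auto simp: frechet_dist_nonneg)
  also have "\<dots> \<le> ?N (\<lambda>i. frechet_dist M' (P' i)) + ?N (\<lambda>i. \<alpha> * d i)"
    using assms(1,2) d by (intro Minkowski_sum_powr) (auto simp: frechet_dist_nonneg)
  \<comment> \<open>M also competes in the p-mean problem for the simplified curves, which M' solves
    optimally.\<close>
  also have "?N (\<lambda>i. frechet_dist M' (P' i)) \<le> ?N (\<lambda>i. frechet_dist M (P' i))"
    using assms(6) M
    by (simp add: p_mean_algorithm_output_def is_p_mean_curve_def p_mean_cost_def P'_def)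
  also have "\<dots> \<le> ?N (\<lambda>i. (1 + \<alpha>) * d i)"
    using assms(1) M_le by (intro powr_sum_mono) (auto simp: frechet_dist_nonneg)
  \<comment> \<open>The factor is the sum of 1 + \<alpha>, from comparing M' with M on the
    simplified curves, and \<alpha>, from the simplification error.\<close>
  also have "\<dots> + ?N (\<lambda>i. \<alpha> * d i) = (2 * \<alpha> + 1) * ?N d"
    using assms(1,2) d by (subst (1 2) powr_sum_cmult) (auto simp: algebra_simps)
  finally show ?thesis
    by (simp add: d_def)
qed

end
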